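(* For every two positive integers $L_1$ and $L_2$ with $L_1 < L_2$, there exists a disconnected graph $G$ such that $\chi(G) = L_1$ and $\chi^{\mathrm{FAT}}(G) = L_2$.
   Context: All graphs are simple with a finite nonempty vertex set. $\chi(G)$ denotes the chromatic number of $G$. For a vertex $v$ and a set $S\subseteq V(G)$, let $e(v,S)=|S\cap N(v)|$, where $N(v)$ is the set of neighbors of $v$ and $\deg(v)=|N(v)|$. A (not necessarily proper) vertex coloring of $G$ with color classes $V_1,\dots,V_k$ is a Fair And Tolerant (FAT) $k$-coloring if $V_1,\dots,V_k$ are all nonempty, they partition $V(G)$, and there exist real numbers $\alpha,\beta\in[0,1]$ such that for every vertex $v$ and every $i\in\{1,\dots,k\}$: $e(v,V_i)=\alpha\deg(v)$ if $v\notin V_i$, and $e(v,V_i)=\beta\deg(v)$ if $v\in V_i$. The FAT chromatic number $\chi^{\mathrm{FAT}}(G)$ is the maximum $k$ such that $G$ admits a FAT $k$-coloring (a FAT $1$-coloring always exists). *)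

theory Defs
  imports Complex_Main "HOL-Library.Disjoint_Sets" "Graph_Theory.Graph_Theory"
begin

text \<open>
  A finite simple graph is a \<open>pair_graph\<close>: a finite, loop-free, symmetric digraph without parallel
  arcs. An edge between \<open>u\<close> and \<open>v\<close> is represented by the two arcs \<open>(u, v)\<close> and \<open>(v, u)\<close>.
  The locale allows the null graph, so nonemptiness of the vertex set is required separately.
\<close>

definition neighbors :: "'a pair_pre_digraph \<Rightarrow> 'a \<Rightarrow> 'a set" where
  "neighbors G v = {w. (v, w) \<in> parcs G}"

definition degree :: "'a pair_pre_digraph \<Rightarrow> 'a \<Rightarrow> nat" where
  "degree G v = card (neighbors G v)"

definition edges_to :: "'a pair_pre_digraph \<Rightarrow> 'a \<Rightarrow> 'a set \<Rightarrow> nat" where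
  "edges_to G v S = card (S \<inter> neighbors G v)"

definition proper_coloring :: "'a pair_pre_digraph \<Rightarrow> nat \<Rightarrow> ('a \<Rightarrow> nat) \<Rightarrow> bool" where
  "proper_coloring G k c \<longleftrightarrow>
     c ` pverts G \<subseteq> {1..k} \<and> (\<forall>(u, v) \<in> parcs G. c u \<noteq> c v)"

definition chromatic_number :: "'a pair_pre_digraph \<Rightarrow> nat" where
  "chromatic_number G = (LEAST k. \<exists>c. proper_coloring G k c)"

text \<open>The color classes are \<open>V 1, \<dots>, V k\<close>; values of \<open>V\<close> at other indices are irrelevant.\<close>

definition FAT_coloring :: "'a pair_pre_digraph \<Rightarrow> nat \<Rightarrow> (nat \<Rightarrow> 'a set) \<Rightarrow> bool" where
  "FAT_coloring G k V \<longleftrightarrow>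
     (\<forall>i\<in>{1..k}. V i \<noteq> {}) \<and>
     disjoint_family_on V {1..k} \<and>
     (\<Union>i\<in>{1..k}. V i) = pverts G \<and>
     (\<exists>\<alpha>\<in>{0..1::real}. \<exists>\<beta>\<in>{0..1::real}. \<forall>v\<in>pverts G. \<forall>i\<in>{1..k}.
        (v \<notin> V i \<longrightarrow> real (edges_to G v (V i)) = \<alpha> * real (degree G v)) \<and>
        (v \<in> V i \<longrightarrow> real (edges_to G v (V i)) = \<beta> * real (degree G v)))"

definition FAT_chromatic_number :: "'a pair_pre_digraph \<Rightarrow> nat" where
  "FAT_chromatic_number G = Max {k. \<exists>V. FAT_coloring G k V}"

text \<open>
  For finite nonempty graphs the minimum and the maximum above range over nonempty sets, and the
  latter set is finite.
\<close>

lemma proper_coloring_exists: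
  assumes "pair_graph G"
  shows "\<exists>k c. proper_coloring G k c"
proof -
  interpret pair_graph G by fact
  obtain f where f: "bij_betw f (pverts G) {1..card (pverts G)}"
    using pair_finite_verts by (metis card_atLeastAtMost diff_Suc_1 finite_atLeastAtMost finite_same_card_bij)
  have "f u \<noteq> f v" if "(u, v) \<in> parcs G" for u v
    using that f in_arcsD1 in_arcsD2 no_loops' unfolding bij_betw_def inj_on_def by blast
  then have "proper_coloring G (card (pverts G)) f"
    using f unfolding proper_coloring_def bij_betw_def by auto
  then show ?thesis by blast
qed

lemma FAT_coloring_one:
  assumes "pair_graph G" "pverts G \<noteq> {}"
  shows "FAT_coloring G 1 (\<lambda>_. pverts G)"
proof -
  interpret pair_graph G by fact
  have "pverts G \<inter> neighbors G v = neighbors G v" for v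
    using in_arcsD2 unfolding neighbors_def by auto
  then have "\<forall>v\<in>pverts G. real (edges_to G v (pverts G)) = 1 * real (degree G v)"
    unfolding edges_to_def degree_def by simp
  then show ?thesis
    using assms(2) unfolding FAT_coloring_def disjoint_family_on_def
    by (auto intro!: bexI[of _ 1])
qed

lemma FAT_coloring_le_card:
  assumes "finite (pverts G)" "FAT_coloring G k V"
  shows "k \<le> card (pverts G)"
proof -
  have ne: "\<forall>i\<in>{1..k}. V i \<noteq> {}" and dj: "disjoint_family_on V {1..k}"
    and un: "(\<Union>i\<in>{1..k}. V i) = pverts G"
    using assms(2) unfolding FAT_coloring_def by auto
  define f where "f i = (SOME x. x \<in> V i)" for i
  have f: "f i \<in> V i" if "i \<in> {1..k}" for i
    using ne that unfolding f_def by (simp add: some_in_eq)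
  have "inj_on f {1..k}"
    using f dj unfolding inj_on_def disjoint_family_on_def by (metis disjoint_iff)
  moreover have "f ` {1..k} \<subseteq> pverts G" using f un by blast
  ultimately have "card {1..k} \<le> card (pverts G)"
    using assms(1) by (metis card_inj_on_le)
  then show ?thesis by simp
qed

end

theory Submission
  imports Defs
begin

text \<open>
  Take \<open>L2\<close> disjoint copies of the complete graph on \<open>L1\<close> vertices. Colouring each copy with its own
  colour is a FAT colouring with \<open>\<alpha> = 0\<close> and \<open>\<beta> = 1\<close>. Conversely, the graph is regular of degree
  \<open>d = L1 - 1\<close>. If \<open>\<alpha> d = 0\<close> in a FAT colouring, then every copy is monochromatic, so there are at
  most \<open>L2\<close> colours; otherwise the copy containing a given vertex meets every colour class, so
  there are at most \<open>L1\<close> colours.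
\<close>

text \<open>Vertex \<open>v\<close> is numbered so that \<open>v div m\<close> names its copy and
  \<open>v mod m\<close> its position in that copy, both counted from 0.\<close>

definition disjoint_cliques :: "nat \<Rightarrow> nat \<Rightarrow> nat pair_pre_digraph" where
  "disjoint_cliques n m =
     \<lparr> pverts = {..<n * m},
       parcs = {(u, v). u < n * m \<and> v < n * m \<and> u \<noteq> v \<and> u div m = v div m} \<rparr>"

lemma pverts_disjoint_cliques [simp]: "pverts (disjoint_cliques n m) = {..<n * m}"
  by (simp add: disjoint_cliques_def)

lemma in_parcs_disjoint_cliques [simp]:
  "(u, v) \<in> parcs (disjoint_cliques n m) \<longleftrightarrow>
     u < n * m \<and> v < n * m \<and> u \<noteq> v \<and> u div m = v div m"
  by (simp add: disjoint_cliques_def)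

lemma card_clique:
  assumes "j < n"
  shows "card {v. v < n * m \<and> v div m = j} = m"
proof -
  have "{v. v < n * m \<and> v div m = j} = {j * m..<Suc j * m}"
  proof (intro set_eqI iffI)
    fix v assume "v \<in> {v. v < n * m \<and> v div m = j}"
    then have "v < n * m" "v div m = j" by auto
    \<comment> \<open>For \<open>m = 0\<close> there are no vertices, so a given \<open>v\<close>
      forces \<open>m\<close> to be positive, as the bounds from \<open>div\<close> require.\<close>
    moreover from this have "0 < m" by (cases m) auto
    ultimately show "v \<in> {j * m..<Suc j * m}"
      by (auto simp: div_nat_eqI dividend_less_times_div mult.commute)
  next
    fix v assume v: "v \<in> {j * m..<Suc j * m}"
    then have "v div m = j" by (intro div_nat_eqI) (auto simp: mult.commute)
    moreover have "Suc j * m \<le> n * m" using assms by (intro mult_le_mono1) simp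
    ultimately show "v \<in> {v. v < n * m \<and> v div m = j}" using v by auto
  qed
  then show ?thesis by simp
qed

lemma neighbors_disjoint_cliques:
  assumes "v < n * m"
  shows "neighbors (disjoint_cliques n m) v = {w. w < n * m \<and> w div m = v div m} - {v}"
  using assms by (auto simp: neighbors_def)

lemma degree_disjoint_cliques:
  assumes "v < n * m"
  shows "degree (disjoint_cliques n m) v = m - 1"
  using assms card_clique[of "v div m" n m]
  by (simp add: degree_def neighbors_disjoint_cliques less_mult_imp_div_less)

lemma pair_graph_disjoint_cliques: "pair_graph (disjoint_cliques n m)"
proof
  have "parcs (disjoint_cliques n m) \<subseteq> {..<n * m} \<times> {..<n * m}" by auto
  then show "finite (parcs (disjoint_cliques n m))" by (rule finite_subset) simp
  show "symmetric (with_proj (disjoint_cliques n m))"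
    by (auto simp: symmetric_def sym_def)
qed auto

text \<open>An arc never changes \<open>v div m\<close>, so no walk leads from vertex 0 to
  \<open>m\<close>, the first vertex of copy 1; that copy exists because \<open>1 < n\<close>.
  Symmetry of the arcs turns connectedness into the reachability that is refuted.\<close>

lemma not_connected_disjoint_cliques:
  assumes "0 < m" "1 < n"
  shows "\<not> Digraph_Component.connected (with_proj (disjoint_cliques n m))"
proof
  let ?G = "disjoint_cliques n m"
  interpret pair_graph ?G by (rule pair_graph_disjoint_cliques)
  assume "Digraph_Component.connected (with_proj ?G)"
  then have "strongly_connected (with_proj ?G)"
    using pair_sym_arcs symmetric_connected_imp_strongly_connected by blast
  then have "0 \<rightarrow>\<^sup>*\<^bsub>with_proj ?G\<^esub> m"
    using assms by (auto simp: strongly_connected_def)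
  moreover have "v div m = 0" if "0 \<rightarrow>\<^sup>*\<^bsub>with_proj ?G\<^esub> v" for v
    using that by (induct rule: reachable_induct) auto
  ultimately have "m div m = 0" by blast
  then show False using assms by simp
qed

text \<open>Positions in the copies serve as colours, shifted by \<open>Suc\<close> into
  \<open>{1..m}\<close>. Fewer colours fail already on copy 0, the clique
  \<open>{..<m}\<close>.\<close>

lemma chromatic_number_disjoint_cliques:
  assumes "0 < m" "0 < n"
  shows "chromatic_number (disjoint_cliques n m) = m"
  unfolding chromatic_number_def
proof (rule Least_equality)
  have "u mod m \<noteq> v mod m" if "u \<noteq> v" "u div m = v div m" for u v :: nat
    using that by (metis div_mult_mod_eq)
  then have "proper_coloring (disjoint_cliques n m) m (\<lambda>v. Suc (v mod m))"
    using assms by (auto simp: proper_coloring_def Suc_le_eq)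
  then show "\<exists>c. proper_coloring (disjoint_cliques n m) m c" by blast
next
  fix k assume "\<exists>c. proper_coloring (disjoint_cliques n m) k c"
  then obtain c where c: "proper_coloring (disjoint_cliques n m) k c" ..
  have le: "v < n * m" if "v < m" for v
    using that assms by (cases n) auto
  have "inj_on c {..<m}"
  proof (rule inj_onI, rule ccontr)
    fix u v assume "u \<in> {..<m}" "v \<in> {..<m}" "c u = c v" "u \<noteq> v"
    then have "(u, v) \<in> parcs (disjoint_cliques n m)" by (simp add: le)
    with c \<open>c u = c v\<close> show False by (auto simp: proper_coloring_def)
  qed
  moreover have "c ` {..<m} \<subseteq> {1..k}"
    using c le unfolding proper_coloring_def by (auto simp: image_subset_iff)
  ultimately show "m \<le> k"
    using card_inj_on_le[of c "{..<m}" "{1..k}"] by simp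
qed

lemma FAT_coloring_disjoint_cliques:
  assumes "0 < m"
  \<comment> \<open>Colours count from 1 and copies from 0, hence \<open>i - 1\<close>; on
    \<open>{1..n}\<close> this subtraction does not truncate, so distinct colours get distinct
    copies.\<close>
  shows "FAT_coloring (disjoint_cliques n m) n (\<lambda>i. {v. v < n * m \<and> v div m = i - 1})"
    (is "FAT_coloring ?G n ?V")
  unfolding FAT_coloring_def
proof (intro conjI)
  show "\<forall>i\<in>{1..n}. ?V i \<noteq> {}"
  proof
    fix i assume "i \<in> {1..n}"
    then have "card (?V i) = m" by (intro card_clique) auto
    with assms have "0 < card (?V i)" by (simp only:)
    then show "?V i \<noteq> {}" unfolding card_gt_0_iff by (rule conjunct1)
  qed
  show "disjoint_family_on ?V {1..n}"
    by (auto simp: disjoint_family_on_def)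
  have "v \<in> (\<Union>i\<in>{1..n}. ?V i)" if "v < n * m" for v
    using that less_mult_imp_div_less[OF that] by (intro UN_I[of "Suc (v div m)"]) auto
  then show "(\<Union>i\<in>{1..n}. ?V i) = pverts ?G" by auto
  have "?V i \<inter> neighbors ?G v = (if v \<in> ?V i then neighbors ?G v else {})"
    if "v < n * m" for v i
    using that by (auto simp: neighbors_disjoint_cliques)
  then show "\<exists>\<alpha>\<in>{0..1::real}. \<exists>\<beta>\<in>{0..1::real}. \<forall>v\<in>pverts ?G. \<forall>i\<in>{1..n}.
      (v \<notin> ?V i \<longrightarrow> real (edges_to ?G v (?V i)) = \<alpha> * real (degree ?G v)) \<and>
      (v \<in> ?V i \<longrightarrow> real (edges_to ?G v (?V i)) = \<beta> * real (degree ?G v))"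
    by (intro bexI[of _ 0] bexI[of _ 1]) (auto simp: edges_to_def degree_def)
qed

lemma FAT_coloring_disjoint_cliques_le:
  assumes "0 < m" "0 < n" "FAT_coloring (disjoint_cliques n m) k V"
  shows "k \<le> max m n"
proof -
  let ?G = "disjoint_cliques n m"
  from assms(3) have
    ne: "\<forall>i\<in>{1..k}. V i \<noteq> {}" and dj: "disjoint_family_on V {1..k}"
    and un: "(\<Union>i\<in>{1..k}. V i) = {..<n * m}"
    unfolding FAT_coloring_def by simp_all
  from assms(3) obtain \<alpha> :: real where
    "\<forall>v<n * m. \<forall>i\<in>{1..k}. v \<notin> V i \<longrightarrow> real (edges_to ?G v (V i)) = \<alpha> * real (degree ?G v)"
    unfolding FAT_coloring_def pverts_disjoint_cliques by (meson lessThan_iff)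
  then have \<alpha>: "real (edges_to ?G v (V i)) = \<alpha> * real (m - 1)"
    if "v < n * m" "i \<in> {1..k}" "v \<notin> V i" for v i
    using that by (metis degree_disjoint_cliques)
  have unique: "i = j" if "i \<in> {1..k}" "j \<in> {1..k}" "x \<in> V i" "x \<in> V j" for i j x
    using that dj unfolding disjoint_family_on_def by blast
  have lt: "x < n * m" if "i \<in> {1..k}" "x \<in> V i" for i x
    using that un by blast
  show ?thesis
  \<comment> \<open>By regularity, this product is the number of neighbours that any vertex has in
    any class not containing it. The edgeless case \<open>m = 1\<close> falls under zero.\<close>
  proof (cases "\<alpha> * real (m - 1) = 0")
    case True
    \<comment> \<open>If \<open>w\<close> were outside \<open>V i\<close>, then \<open>v\<close>,
      being in the same copy, would be a neighbour of \<open>w\<close> inside \<open>V i\<close>,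
      where \<open>w\<close> has none.\<close>
    have monochromatic: "w \<in> V i"
      if "i \<in> {1..k}" "v \<in> V i" "w < n * m" "v div m = w div m" for i v w
    proof (rule ccontr)
      assume "w \<notin> V i"
      with that have "real (edges_to ?G w (V i)) = 0"
        using \<alpha>[of w i] unfolding True by blast
      then have "card (V i \<inter> neighbors ?G w) = 0" by (simp add: edges_to_def)
      \<comment> \<open>Since \<open>card\<close> is 0 on infinite sets too, finiteness is what
        makes the intersection empty.\<close>
      moreover have "finite (V i)"
        by (rule finite_subset[OF _ finite_lessThan[of "n * m"]]) (use lt that(1) in blast)
      moreover have "v \<in> V i \<inter> neighbors ?G w"
        using that lt \<open>w \<notin> V i\<close> by (auto simp: neighbors_disjoint_cliques)
      ultimately show False by auto
    qed
    have "\<forall>i\<in>{1..k}. \<exists>x. x \<in> V i" using ne by blast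
    from bchoice[OF this] obtain f where f: "\<And>i. i \<in> {1..k} \<Longrightarrow> f i \<in> V i" by blast
    \<comment> \<open>Representatives of two classes in one copy would put both into the same class,
      so colours inject into the \<open>n\<close> copies.\<close>
    have "inj_on (\<lambda>i. f i div m) {1..k}"
    proof (rule inj_onI)
      fix i j assume ij: "i \<in> {1..k}" "j \<in> {1..k}" "f i div m = f j div m"
      then have "f j \<in> V i" using monochromatic f lt by blast
      then show "i = j" using ij f unique by blast
    qed
    moreover have "(\<lambda>i. f i div m) ` {1..k} \<subseteq> {..<n}"
      using f lt less_mult_imp_div_less by blast
    ultimately have "card {1..k} \<le> card {..<n}"
      by (rule card_inj_on_le) simp
    then show ?thesis by simp
  next
    case False
    \<comment> \<open>Vertex 0 either lies in \<open>V i\<close> or has a nonzero number of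
      neighbours there, so every class meets copy 0. Disjointness of the classes then injects the
      colours into its \<open>m\<close> vertices.\<close>
    have "\<exists>x \<in> V i. x < n * m \<and> x div m = 0" if i: "i \<in> {1..k}" for i
    proof (cases "0 \<in> V i")
      case True
      then show ?thesis using assms by (intro bexI[of _ 0]) auto
    next
      case 0: False
      have pos: "0 < n * m" using assms by simp
      have "card (V i \<inter> neighbors ?G 0) \<noteq> 0"
        using \<alpha>[OF pos i 0] False unfolding edges_to_def by linarith
      then obtain x where "x \<in> V i \<inter> neighbors ?G 0" by (metis card.empty ex_in_conv)
      then show ?thesis using pos by (auto simp: neighbors_disjoint_cliques)
    qed
    then have "\<forall>i\<in>{1..k}. \<exists>x. x \<in> V i \<and> x < n * m \<and> x div m = 0" by blast
    from bchoice[OF this] obtain f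
      where f: "\<forall>i\<in>{1..k}. f i \<in> V i \<and> f i < n * m \<and> f i div m = 0" ..
    have "inj_on f {1..k}"
      using f by (intro inj_onI unique) auto
    moreover have "f ` {1..k} \<subseteq> {v. v < n * m \<and> v div m = 0}"
      using f by (intro image_subsetI CollectI) (drule bspec, assumption, erule conjunct2)
    moreover have "finite {v. v < n * m \<and> v div m = 0}"
      by (rule finite_subset[OF _ finite_lessThan[of "n * m"]]) auto
    ultimately have "card {1..k} \<le> card {v. v < n * m \<and> v div m = 0}"
      by (rule card_inj_on_le)
    also have "\<dots> = m" using assms(2) by (rule card_clique)
    finally show ?thesis by simp
  qed
qed

lemma FAT_chromatic_number_disjoint_cliques:
  assumes "0 < m" "m \<le> n"
  shows "FAT_chromatic_number (disjoint_cliques n m) = n"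
  unfolding FAT_chromatic_number_def
proof (rule Max_eqI)
  \<comment> \<open>As \<open>m \<le> n\<close>, the bound \<open>max m n\<close> is
    \<open>n\<close>. It also yields the finiteness on which \<open>Max\<close> depends.\<close>
  have le: "k \<le> n" if "k \<in> {k. \<exists>V. FAT_coloring (disjoint_cliques n m) k V}" for k
    using that FAT_coloring_disjoint_cliques_le[of m n k] assms by auto
  then show "finite {k. \<exists>V. FAT_coloring (disjoint_cliques n m) k V}"
    by (meson finite_nat_set_iff_bounded_le)
  show "k \<le> n" if "k \<in> {k. \<exists>V. FAT_coloring (disjoint_cliques n m) k V}" for k
    using that by (rule le)
  show "n \<in> {k. \<exists>V. FAT_coloring (disjoint_cliques n m) k V}"
    using FAT_coloring_disjoint_cliques[OF assms(1)] by blast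
qed

theorem theorem2p1:
  fixes L1 L2 :: nat
  assumes "0 < L1" and "0 < L2" and "L1 < L2"
  shows "\<exists>G :: nat pair_pre_digraph.
           pair_graph G \<and> pverts G \<noteq> {} \<and>
           \<not> Digraph_Component.connected (with_proj G) \<and>
           chromatic_number G = L1 \<and> FAT_chromatic_number G = L2"
proof (intro exI conjI)
  \<comment> \<open>From \<open>0 < L1 < L2\<close> there are at least two nonempty copies, and the
    number of copies dominates their size.\<close>
  let ?G = "disjoint_cliques L2 L1"
  show "pair_graph ?G" by (rule pair_graph_disjoint_cliques)
  show "pverts ?G \<noteq> {}" using assms by (auto simp: lessThan_empty_iff)
  show "\<not> Digraph_Component.connected (with_proj ?G)"
    using assms by (intro not_connected_disjoint_cliques) auto
  show "chromatic_number ?G = L1"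
    using assms by (intro chromatic_number_disjoint_cliques) auto
  show "FAT_chromatic_number ?G = L2"
    using assms by (intro FAT_chromatic_number_disjoint_cliques) auto
qed

end
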